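(* Let $f$ be a probability density on $[0,\infty)$ with $0<W=\int_0^\infty t f(t)\,dt<\infty$, $f\in C^{(2)}([0,\infty))$ and $\sup_{t\ge 0}|f''(t)|<\infty$. Let $Y_1,Y_2,\dots$ be i.i.d. with density $g(y)=\frac{1}{W}\,y f(y)$, $y\ge 0$, and fix $x>0$ with $f(x)>0$. For positive integers $n,\alpha$ let $$\widehat f^*_\alpha(x)=\frac1n\sum_{i=1}^n \frac{W}{Y_i^2}\cdot\frac{1}{\Gamma(\alpha)}\Big(\frac{\alpha Y_i}{x}\Big)^{\alpha}\exp\Big(-\frac{\alpha}{x}Y_i\Big),\qquad f_\alpha(x)=E\widehat f^*_\alpha(x).$$ If $\alpha=\alpha(n)\sim n^\delta$ for some $0<\delta<2$, then, as $n\to\infty$ (so $\alpha\to\infty$), $$\frac{\widehat f^*_\alpha(x)-f_\alpha(x)}{\sqrt{\mathrm{Var}\,\widehat f^*_\alpha(x)}}\to_d \mathrm{Normal}(0,1).$$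
   Context: This is the length-biased sampling model: $f$ is the target density and one observes $Y_1,\dots,Y_n$ from $g$; $W$ is treated as known in the estimator. $\to_d$ denotes convergence in distribution; $a_n\sim b_n$ means $a_n/b_n\to1$. *)

theory Defs
  imports "HOL-Probability.Probability"
begin

definition lb_density :: "(real \<Rightarrow> real) \<Rightarrow> real \<Rightarrow> real \<Rightarrow> real" where
  "lb_density f W y = indicator {0..} y * (1 / W * y * f y)"

(* The term with Y i \<omega> = 0 gets a junk value from division by zero; under the model this
   is a null event. *)
definition lb_estimator ::
  "real \<Rightarrow> (nat \<Rightarrow> 'a \<Rightarrow> real) \<Rightarrow> nat \<Rightarrow> nat \<Rightarrow> real \<Rightarrow> 'a \<Rightarrow> real" where
  "lb_estimator W Y n a x \<omega> =
     1 / real n * (\<Sum>i=1..n. W / (Y i \<omega>)\<^sup>2 * (1 / Gamma (real a)) *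
       (real a * Y i \<omega> / x) ^ a * exp (- (real a / x) * Y i \<omega>))"

end

theory Submission
  imports Defs
begin

text \<open>
  The estimator is the average of \<open>n\<close> independent copies of \<open>K(Y)\<close>, where the kernel \<open>K\<close> depends on
  \<open>n\<close> through the shape parameter \<open>a = \<alpha> n\<close>. So this is a central limit theorem for a triangular array
  with i.i.d. rows, and it suffices that a centred summand, divided by the standard deviation of the
  row sum, is bounded by a null sequence (\<open>clt_bounded_sample_mean\<close>, proved with characteristic
  functions).

  As a function of \<open>y\<close>, the kernel is \<open>W / y\<close> times a gamma density concentrated around \<open>x\<close> on the scale
  \<open>x / sqrt a\<close>; its peak therefore has height of order \<open>sqrt a\<close>. With Stirling's formula up to a constant
  factor this becomes three facts:

  \<^item> \<open>K\<close> is at most a constant times \<open>sqrt a\<close> on the half line (\<open>lb_kernel_le\<close>);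

  \<^item> the second moment of \<open>K(Y)\<close> is at least a constant times \<open>sqrt a\<close>, because \<open>K\<^sup>2\<close> is of order \<open>a\<close> on
    a window of length \<open>x / sqrt a\<close> next to \<open>x\<close>, where the density of \<open>Y\<close> is bounded below
    (\<open>lb_kernel_second_moment_ge\<close>);

  \<^item> the mean of \<open>K(Y)\<close> is the integral of \<open>f\<close> against a gamma density with mean \<open>x\<close>, and it stays bounded
    because \<open>f\<close> grows at most quadratically when its second derivative is bounded
    (\<open>lb_kernel_expectation_le\<close>).

  Hence the variance of \<open>K(Y)\<close> is eventually at least a constant times \<open>sqrt a\<close>, and a normalised summand
  is of order \<open>sqrt a / sqrt (n * sqrt a) = sqrt (sqrt a / n)\<close>. For \<open>a\<close> of order \<open>n\<close> to the power \<open>\<delta>\<close>,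
  the quotient \<open>sqrt a / n\<close> has order \<open>n\<close> to the power \<open>\<delta> / 2 - 1\<close>, a null sequence since \<open>\<delta> < 2\<close>.
\<close>

section \<open>Factorials up to a constant factor\<close>

lemma power_divide_exp1: "(c / exp 1) ^ k = c ^ k * exp (- real k)"
  for c :: real
proof -
  have "exp (real k) = exp 1 ^ k" using exp_of_nat_mult[of k "1::real"] by simp
  then show ?thesis by (simp add: power_divide exp_minus divide_inverse power_mult_distrib power_inverse)
qed

text \<open>Let \<open>r k\<close> be the logarithm of \<open>k! / (sqrt k * (k / e)\<^sup>k)\<close>. The increment \<open>r (k + 1) - r k\<close> compares
  \<open>ln (k + 1) - ln k\<close>, an integral of the convex function \<open>1 / t\<close>, with its midpoint value, which shows
  that \<open>r\<close> decreases, and the trapezoid rule shows that \<open>r k - 1 / (4 k)\<close> increases. As \<open>r 1 = 1\<close>, all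
  \<open>r k\<close> lie in \<open>[3/4, 1]\<close>; the coarser range \<open>[0, 1]\<close> gives the constants \<open>1\<close> and \<open>e\<close>.\<close>

lemma stirling_bounds:
  fixes k :: nat
  assumes "k \<ge> 1"
  shows "sqrt k * (k / exp 1) ^ k \<le> fact k" "fact k \<le> exp 1 * sqrt k * (k / exp 1) ^ k"
proof -
  define r where "r j = ln (fact j) - (real j + 1/2) * ln j + j" for j :: nat
  have step: "1 / (4 * real (Suc j)) - 1 / (4 * real j) \<le> r (Suc j) - r j \<and> r (Suc j) - r j \<le> 0"
    if "j \<ge> 1" for j
  proof -
    define L where "L = ln (real j + 1) - ln (real j)"
    have j: "real j > 0" using that by simp
    have "ln (fact (Suc j) :: real) = ln (real j + 1) + ln (fact j)"
    proof -
      have "(fact (Suc j) :: real) = (real j + 1) * fact j" by (simp add: algebra_simps)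
      then show ?thesis by (simp only: ln_mult_pos fact_gt_zero)
    qed
    then have "r (Suc j) - r j = 1 - (real j + 1/2) * L"
      by (simp add: r_def L_def algebra_simps del: fact_Suc)
    moreover have "(real j + 1/2) * L \<le> 1 + (1 / (4 * real j) - 1 / (4 * real (Suc j)))"
    proof -
      have "L \<le> (inverse (real j) + inverse (real j + 1)) / 2"
        using ln_inverse_approx_le[of "real j" 1] j by (simp add: L_def)
      then have "(real j + 1/2) * L \<le> (real j + 1/2) * ((inverse (real j) + inverse (real j + 1)) / 2)"
        by (intro mult_left_mono) auto
      also have "\<dots> = 1 + (1 / (4 * real j) - 1 / (4 * real (Suc j)))"
        using j by (simp add: divide_simps) (simp add: algebra_simps)
      finally show ?thesis .
    qed
    moreover have "(real j + 1/2) * L \<ge> 1"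
    proof -
      have "L \<ge> 2 / (2 * real j + 1)"
        using ln_inverse_approx_ge[of "real j" "real j + 1"] j by (simp add: L_def algebra_simps)
      then have "(real j + 1/2) * L \<ge> (real j + 1/2) * (2 / (2 * real j + 1))"
        by (intro mult_left_mono) auto
      then show ?thesis using j by (simp add: field_simps)
    qed
    ultimately show ?thesis by linarith
  qed
  have r: "3/4 + 1 / (4 * real k) \<le> r k \<and> r k \<le> 1"
    using assms
  proof (induction k rule: nat_induct_at_least)
    case base
    then show ?case by (simp add: r_def)
  next
    case (Suc n)
    then show ?case using step[of n] by linarith
  qed
  have k: "real k > 0" using assms by simp
  have e: "exp (r k) * (sqrt k * (k / exp 1) ^ k) = fact k"
  proof -
    have "(sqrt k * (k / exp 1) ^ k) = exp ((real k + 1/2) * ln k - k)"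
    proof (rule ln_inj_iff[THEN iffD1])
      show "ln (sqrt k * (k / exp 1) ^ k) = ln (exp ((real k + 1/2) * ln k - k))"
        using k by (simp add: ln_mult ln_div ln_realpow ln_sqrt algebra_simps)
    qed (use k in auto)
    then have "exp (r k) * (sqrt k * (k / exp 1) ^ k) = exp (r k + ((real k + 1/2) * ln k - k))"
      by (simp only: exp_add)
    also have "\<dots> = fact k" by (simp add: r_def)
    finally show ?thesis .
  qed
  let ?s = "sqrt k * (k / exp 1) ^ k"
  have s: "?s \<ge> 0" by simp
  have "0 \<le> r k" using r k by (smt (verit) divide_nonneg_nonneg)
  then have "1 * ?s \<le> exp (r k) * ?s" "exp (r k) * ?s \<le> exp 1 * ?s"
    using r by (intro mult_right_mono[OF _ s]; simp)+
  then show "?s \<le> fact k" "fact k \<le> exp 1 * sqrt k * (k / exp 1) ^ k"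
    using e by (auto simp: mult.assoc)
qed

text \<open>The left-hand side peaks at \<open>u = k\<close>. With \<open>stirling_bounds\<close> it says that a Poisson weight is at most
  \<open>1 / sqrt k\<close>.\<close>

lemma power_exp_le_peak:
  fixes u :: real
  assumes "k \<ge> 1" "u \<ge> 0"
  shows "u ^ k * exp (- u) \<le> (k / exp 1) ^ k"
proof -
  have k: "real k > 0" using assms by simp
  have "u / k \<le> exp (u / k - 1)"
    using exp_ge_add_one_self[of "u / k - 1"] by simp
  then have "(u / k) ^ k \<le> exp (u / k - 1) ^ k"
    using assms by (intro power_mono) auto
  also have "\<dots> = exp (u - k)"
    using k by (simp add: exp_of_nat_mult[symmetric] algebra_simps)
  finally have "u ^ k \<le> exp (u - k) * real k ^ k"
    using k by (simp add: power_divide field_simps)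
  then have "u ^ k * exp (- u) \<le> exp (u - k) * real k ^ k * exp (- u)"
    by (intro mult_right_mono) auto
  also have "\<dots> = real k ^ k * exp (- real k)" by (simp add: mult_exp_exp)
  also have "\<dots> = (k / exp 1) ^ k" by (simp only: power_divide_exp1)
  finally show ?thesis .
qed

section \<open>Size of the gamma kernel\<close>

definition lb_kernel :: "real \<Rightarrow> nat \<Rightarrow> real \<Rightarrow> real \<Rightarrow> real" where
  "lb_kernel W a x y = W / y\<^sup>2 * (1 / Gamma (real a)) * (real a * y / x) ^ a * exp (- (real a / x) * y)"

lemma lb_estimator_eq_kernel_mean:
  "lb_estimator W Y n a x \<omega> = (\<Sum>i=1..n. lb_kernel W a x (Y i \<omega>)) / n"
  by (simp add: lb_estimator_def lb_kernel_def)

lemma Gamma_nat: "a \<ge> 1 \<Longrightarrow> Gamma (real a) = fact (a - 1)"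
  using Gamma_fact[of "a - 1", where 'a = real] by (simp add: of_nat_diff)

lemma measurable_lb_kernel [measurable]: "lb_kernel W a x \<in> borel_measurable borel"
  unfolding lb_kernel_def[abs_def] by measurable

lemma lb_kernel_nonneg: "W \<ge> 0 \<Longrightarrow> x > 0 \<Longrightarrow> y \<ge> 0 \<Longrightarrow> a \<ge> 1 \<Longrightarrow> lb_kernel W a x y \<ge> 0"
  by (simp add: lb_kernel_def Gamma_nat)

text \<open>In the variable \<open>u = a * y / x\<close> the factor \<open>1 / y\<^sup>2\<close> lowers the exponent by two, so the kernel is
  \<open>W * a\<^sup>2 / (x\<^sup>2 * (a - 1))\<close> times the Poisson weight of \<open>a - 2\<close> with mean \<open>u\<close>, which is bounded by
  \<open>1 / sqrt (a - 2)\<close>. The assumption \<open>a \<ge> 3\<close> keeps this index positive; for \<open>a = 1\<close> the kernel is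
  unbounded near the origin.\<close>

lemma lb_kernel_le:
  assumes a: "a \<ge> 3" and "W \<ge> 0" "x > 0" "y \<ge> 0"
  shows "lb_kernel W a x y \<le> 4 * W / x\<^sup>2 * sqrt a"
proof (cases "y = 0")
  case True
  then show ?thesis using assms by (simp add: lb_kernel_def)
next
  case False
  then have y: "y > 0" using assms by simp
  define k where "k = a - 2"
  have k: "k \<ge> 1" and a_k: "a = k + 2" using a by (auto simp: k_def)
  define u where "u = real a * y / x"
  have u: "u > 0" using y assms by (simp add: u_def)
  have p: "u ^ k * exp (- u) * sqrt k \<le> fact k"
  proof -
    have "u ^ k * exp (- u) * sqrt k \<le> (k / exp 1) ^ k * sqrt k"
      using power_exp_le_peak[OF k, of u] u by (intro mult_right_mono) auto
    then show ?thesis using stirling_bounds(1)[OF k] by (simp add: mult.commute)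
  qed
  have G: "Gamma (real a) = (real k + 1) * fact k"
    using Gamma_nat[of a] a_k by simp
  have y2: "W / y\<^sup>2 * u\<^sup>2 = W * (real a)\<^sup>2 / x\<^sup>2"
    using y by (simp add: u_def power_divide power_mult_distrib)
  have "lb_kernel W a x y = W / y\<^sup>2 * (1 / Gamma (real a)) * u ^ a * exp (- u)"
    by (simp add: lb_kernel_def u_def)
  also have "u ^ a = u\<^sup>2 * u ^ k" by (simp add: a_k power2_eq_square)
  also have "W / y\<^sup>2 * (1 / Gamma (real a)) * (u\<^sup>2 * u ^ k) * exp (- u)
      = (W / y\<^sup>2 * u\<^sup>2) * (u ^ k * exp (- u)) / Gamma (real a)"
    by simp
  also have "\<dots> = W / x\<^sup>2 * ((real a)\<^sup>2 * (u ^ k * exp (- u)) / ((real k + 1) * fact k))"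
    by (simp only: y2 G) simp
  also have "\<dots> \<le> W / x\<^sup>2 * (4 * sqrt a)"
  proof (intro mult_left_mono)
    have s: "sqrt a \<le> 2 * sqrt k"
    proof -
      have "sqrt a \<le> sqrt (4 * real k)" using k a_k by simp
      then show ?thesis by (simp add: real_sqrt_mult)
    qed
    have "(real a)\<^sup>2 * (u ^ k * exp (- u)) = (real a * sqrt a) * (sqrt a * (u ^ k * exp (- u)))"
      by (simp add: power2_eq_square)
    also have "\<dots> \<le> (real a * sqrt a) * (2 * sqrt k * (u ^ k * exp (- u)))"
      using s u by (intro mult_left_mono mult_right_mono) auto
    also have "\<dots> \<le> (real a * sqrt a) * (2 * fact k)"
      using p by (intro mult_left_mono) (auto simp: algebra_simps)
    also have "\<dots> \<le> (2 * (real k + 1)) * sqrt a * (2 * fact k)"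
      by (intro mult_right_mono) (auto simp: a_k)
    finally show "(real a)\<^sup>2 * (u ^ k * exp (- u)) / ((real k + 1) * fact k) \<le> 4 * sqrt a"
      by (simp add: divide_le_eq mult_ac)
  qed (use assms in auto)
  finally show ?thesis by (simp add: mult_ac)
qed

text \<open>With \<open>y = x * (1 + s)\<close> the gamma weight is its value at \<open>s = 0\<close> times \<open>exp (a * (ln (1 + s) - s))\<close>. As
  \<open>ln (1 + s) - s \<ge> - s\<^sup>2\<close>, this costs at most a factor \<open>e\<close> on the window \<open>s \<le> 1 / sqrt a\<close>. The peak
  itself is bounded below by Stirling's formula at the cost of another factor \<open>e\<close>, and \<open>y \<le> 2 * x\<close>
  accounts for the \<open>4\<close>.\<close>

lemma lb_kernel_ge:
  assumes a: "a \<ge> 1" and W: "W \<ge> 0" and x: "x > 0"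
    and y: "x \<le> y" "y \<le> x + x / sqrt a"
  shows "W / (4 * exp 2 * x\<^sup>2) * sqrt a \<le> lb_kernel W a x y"
proof -
  define s where "s = y / x - 1"
  have a0: "real a > 0" "sqrt a > 0" using a by auto
  have s: "0 \<le> s" "s \<le> 1 / sqrt a" using x y by (auto simp: s_def field_simps)
  have s1: "s \<le> 1"
    using s(2) a by (smt (verit) divide_le_eq_1 of_nat_1 of_nat_le_iff real_sqrt_ge_1_iff)
  have ys: "y = x * (1 + s)" using x by (simp add: s_def)
  have y0: "y > 0" "y \<le> 2 * x" using x s s1 by (auto simp: ys)
  have as: "a * s\<^sup>2 \<le> 1"
  proof -
    have "s\<^sup>2 \<le> (1 / sqrt a)\<^sup>2" using s by (intro power_mono) auto
    also have "\<dots> = 1 / a" by (simp add: power_divide)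
    finally show ?thesis using a0 by (simp add: field_simps)
  qed
  have e: "exp (- 1 - real a) \<le> (1 + s) ^ a * exp (- (a * (1 + s)))"
  proof -
    have "- 1 - real a \<le> a * (s - s\<^sup>2) - a * (1 + s)"
      using as by (simp add: algebra_simps)
    also have "\<dots> \<le> a * ln (1 + s) - a * (1 + s)"
      using ln_one_plus_pos_lower_bound[OF s(1) s1] by (simp add: mult_left_mono)
    finally have "exp (- 1 - real a) \<le> exp (a * ln (1 + s) - a * (1 + s))" by simp
    also have "\<dots> = (1 + s) ^ a * exp (- (a * (1 + s)))"
      using s by (simp add: exp_diff exp_minus exp_of_nat_mult divide_inverse)
    finally show ?thesis .
  qed
  have G: "Gamma (real a) * a = fact a"
    using Gamma_nat[of a] a by (simp add: fact_reduce)
  have G0: "Gamma (real a) > 0" using a0 by simp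
  have "fact a \<le> exp 1 * sqrt a * (a / exp 1) ^ a"
    by (rule stirling_bounds(2)[OF a])
  also have "(a / exp 1) ^ a = real a ^ a * exp (- real a)"
    by (rule power_divide_exp1)
  finally have "Gamma (real a) * a \<le> exp 1 * sqrt a * (real a ^ a * exp (- real a))" using G by simp
  then have "(Gamma (real a) * sqrt a) * sqrt a \<le> (exp 1 * (real a ^ a * exp (- real a))) * sqrt a"
    by (simp add: mult_ac)
  then have G1: "sqrt a * Gamma (real a) \<le> exp 1 * (real a ^ a * exp (- real a))"
    using a0 by (simp add: mult.commute)
  have "W / (4 * exp 2 * x\<^sup>2) * sqrt a
      = W / (2 * x)\<^sup>2 * (1 / Gamma (real a)) * (exp (- 2) * (sqrt a * Gamma (real a)))"
    using G0 by (simp add: exp_minus field_simps)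
  also have "\<dots> \<le> W / (2 * x)\<^sup>2 * (1 / Gamma (real a)) * (exp (- 2) * (exp 1 * (real a ^ a * exp (- real a))))"
    using G1 G0 W by (intro mult_left_mono) auto
  also have "exp (- 2) * (exp 1 * (real a ^ a * exp (- real a))) = real a ^ a * exp (- 1 - real a)"
    by (simp add: mult_exp_exp mult.left_commute)
  also have "W / (2 * x)\<^sup>2 * (1 / Gamma (real a)) * (real a ^ a * exp (- 1 - real a))
      \<le> W / y\<^sup>2 * (1 / Gamma (real a)) * (real a ^ a * ((1 + s) ^ a * exp (- (a * (1 + s)))))"
    using W G0 y0 e x by (intro mult_mono divide_left_mono power_mono) auto
  also have "\<dots> = lb_kernel W a x y"
    using x by (simp add: lb_kernel_def ys power_mult_distrib mult_ac)
  finally show ?thesis .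
qed

section \<open>First and second moment of the kernel\<close>

text \<open>The length bias \<open>y / W\<close> cancels \<open>W\<close> and one power of \<open>1 / y\<^sup>2\<close>; the other one turns the gamma weight
  into the Erlang density with mean \<open>x\<close>. For \<open>a = 1\<close> this density is positive at
  \<open>y = 0\<close>, where the left-hand side vanishes.\<close>

lemma lb_density_times_kernel:
  assumes "a \<ge> 2" "W > 0" "x > 0"
  shows "lb_density f W y * lb_kernel W a x y = erlang_density (a - 1) (a / x) y * f y"
proof (cases "y > 0")
  case True
  obtain b where b: "a = Suc b" using assms by (cases a) auto
  have G: "Gamma (real a) = fact b" using Gamma_nat[of a] by (simp add: b)
  have p: "(real a * y / x) ^ a = (a / x) ^ Suc b * (y * y ^ b)"
    by (simp add: b power_mult_distrib power_divide)
  have "lb_density f W y * lb_kernel W a x y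
      = (1 / W * y * f y) * (W / y\<^sup>2 * (1 / fact b) * ((a / x) ^ Suc b * (y * y ^ b)) * exp (- (a / x) * y))"
    using True by (simp only: lb_density_def lb_kernel_def G p) simp
  also have "\<dots> = (a / x) ^ Suc b * y ^ b * exp (- (a / x) * y) / fact b * f y"
    using True assms(2) by (simp add: field_simps power2_eq_square del: power_Suc)
  also have "\<dots> = erlang_density (a - 1) (a / x) y * f y"
    using True by (simp add: erlang_density_def b)
  finally show ?thesis .
next
  case False
  then show ?thesis using assms
    by (cases "y = 0") (auto simp: lb_density_def erlang_density_def)
qed

text \<open>Integrate the bound on \<open>f''\<close> twice; the linear term is absorbed by \<open>t \<le> 1 + t\<^sup>2\<close>.\<close>

lemma quadratic_growth_of_bounded_second_deriv:
  fixes f f' f'' :: "real \<Rightarrow> real"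
  assumes f': "\<And>t. t \<ge> 0 \<Longrightarrow> (f has_real_derivative f' t) (at t within {0..})"
    and f'': "\<And>t. t \<ge> 0 \<Longrightarrow> (f' has_real_derivative f'' t) (at t within {0..})"
    and bdd: "bounded (f'' ` {0..})"
  obtains A B where "A \<ge> 0" "B \<ge> 0" "\<And>t. t \<ge> 0 \<Longrightarrow> f t \<le> A + B * t\<^sup>2"
proof -
  obtain C where C: "C > 0" "\<And>t. t \<ge> 0 \<Longrightarrow> \<bar>f'' t\<bar> \<le> C"
    using bdd by (force simp: bounded_pos)
  have d: "\<bar>f' t\<bar> \<le> \<bar>f' 0\<bar> + C * t" if "t \<ge> 0" for t
  proof -
    have "norm (f' t - f' 0) \<le> C * norm (t - 0)"
      by (rule field_differentiable_bound[where S = "{0..}" and f' = f'']) (use f'' C that in auto)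
    then show ?thesis using that by auto
  qed
  have g: "f t \<le> \<bar>f 0\<bar> + \<bar>f' 0\<bar> + (\<bar>f' 0\<bar> + C) * t\<^sup>2" if t: "t \<ge> 0" for t
  proof -
    have "norm (f t - f 0) \<le> (\<bar>f' 0\<bar> + C * t) * norm (t - 0)"
    proof (rule field_differentiable_bound[where S = "{0..t}" and f' = f'])
      fix z assume z: "z \<in> {0..t}"
      then show "(f has_real_derivative f' z) (at z within {0..t})"
        by (intro has_field_derivative_subset[OF f']) auto
      have "C * z \<le> C * t" using z C by simp
      then show "norm (f' z) \<le> \<bar>f' 0\<bar> + C * t" using d[of z] z by auto
    qed (use t in auto)
    then have "f t \<le> \<bar>f 0\<bar> + \<bar>f' 0\<bar> * t + C * t\<^sup>2"
      using t by (auto simp: algebra_simps power2_eq_square)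
    moreover have "t \<le> 1 + t\<^sup>2"
      using zero_le_power2[of "t - 1/2"] by (simp add: power2_eq_square algebra_simps)
    then have "\<bar>f' 0\<bar> * t \<le> \<bar>f' 0\<bar> * (1 + t\<^sup>2)" by (intro mult_left_mono) auto
    ultimately show ?thesis by (simp add: algebra_simps)
  qed
  show thesis
    by (rule that[OF _ _ g]) (use C in auto)
qed

text \<open>The second moment of this Erlang law is \<open>x\<^sup>2 * (1 + 1 / a)\<close>, hence at most \<open>2 * x\<^sup>2\<close> whatever \<open>a\<close> is. The
  expectation is taken as a nonnegative integral so that integrability of \<open>f\<close> under the law need not be
  known beforehand.\<close>

lemma erlang_nn_expectation_le:
  assumes a: "a \<ge> 1" and x: "x > 0" and AB: "A \<ge> 0" "B \<ge> 0"
    and f: "\<And>y. y \<ge> 0 \<Longrightarrow> f y \<le> A + B * y\<^sup>2"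
  shows "(\<integral>\<^sup>+y. ennreal (erlang_density (a - 1) (a / x) y * f y) \<partial>lborel) \<le> ennreal (A + 2 * B * x\<^sup>2)"
proof -
  let ?e = "erlang_density (a - 1) (a / x)"
  have l: "real a / x > 0" using a x by simp
  have e0: "?e y \<ge> 0" for y using x by simp
  have "(\<integral>\<^sup>+y. ennreal (?e y * f y) \<partial>lborel)
      \<le> (\<integral>\<^sup>+y. ennreal A * ennreal (?e y * y ^ 0) + ennreal B * ennreal (?e y * y ^ 2) \<partial>lborel)"
  proof (intro nn_integral_mono)
    fix y :: real
    show "ennreal (?e y * f y)
        \<le> ennreal A * ennreal (?e y * y ^ 0) + ennreal B * ennreal (?e y * y ^ 2)"
    proof (cases "y \<ge> 0")
      case True
      have "?e y * f y \<le> ?e y * (A + B * y\<^sup>2)" using f[OF True] e0 by (intro mult_left_mono)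
      also have "\<dots> = A * (?e y * y ^ 0) + B * (?e y * y ^ 2)" by (simp add: algebra_simps)
      finally have "ennreal (?e y * f y) \<le> ennreal (A * (?e y * y ^ 0) + B * (?e y * y ^ 2))"
        by (rule ennreal_leI)
      also have "\<dots> = ennreal A * ennreal (?e y * y ^ 0) + ennreal B * ennreal (?e y * y ^ 2)"
        using AB e0 by (simp add: ennreal_mult)
      finally show ?thesis .
    qed (simp add: erlang_density_def)
  qed
  also have "\<dots> = ennreal A * (\<integral>\<^sup>+y. ennreal (?e y * y ^ 0) \<partial>lborel)
      + ennreal B * (\<integral>\<^sup>+y. ennreal (?e y * y ^ 2) \<partial>lborel)"
    by (subst nn_integral_add) (auto simp: nn_integral_cmult)
  also have "(\<integral>\<^sup>+y. ennreal (?e y * y ^ 0) \<partial>lborel) = 1"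
    using nn_integral_erlang_ith_moment[OF l, of "a - 1" 0] by simp
  also have "(\<integral>\<^sup>+y. ennreal (?e y * y ^ 2) \<partial>lborel) \<le> ennreal (2 * x\<^sup>2)"
  proof -
    obtain b where b: "a = Suc b" using a by (cases a) auto
    have "(\<integral>\<^sup>+y. ennreal (?e y * y ^ 2) \<partial>lborel)
        = ennreal (fact (a - 1 + 2) / (fact (a - 1) * (a / x) ^ 2))"
      by (rule nn_integral_erlang_ith_moment[OF l])
    also have "fact (a - 1 + 2) / (fact (a - 1) * (a / x) ^ 2) = x\<^sup>2 * ((real b + 2) / (real b + 1))"
    proof -
      have "fact (a - 1 + 2) = (real b + 2) * (real b + 1) * fact b"
        by (simp add: b numeral_2_eq_2 algebra_simps)
      then have "fact (a - 1 + 2) / (fact (a - 1) * (a / x) ^ 2)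
          = (real b + 2) * (real b + 1) / (a / x) ^ 2"
        by (simp add: b)
      also have "\<dots> = x\<^sup>2 * ((real b + 2) / (real b + 1))"
        using x by (simp add: b power_divide power2_eq_square add.commute)
      finally show ?thesis .
    qed
    also have "ennreal \<dots> \<le> ennreal (x\<^sup>2 * 2)"
      by (intro ennreal_leI mult_left_mono) (auto simp: divide_le_eq)
    finally show ?thesis by (simp add: mult.commute)
  qed
  also have "ennreal A * 1 + ennreal B * ennreal (2 * x\<^sup>2) = ennreal (A + 2 * B * x\<^sup>2)"
    using AB by (simp add: ennreal_mult[symmetric] mult_ac)
  finally show ?thesis by (simp add: add_left_mono mult_left_mono)
qed

lemma (in prob_space) lb_kernel_expectation_le:
  assumes Y: "distributed M lborel Y (\<lambda>y. ennreal (lb_density f W y))"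
    and f: "\<And>t. t \<ge> 0 \<Longrightarrow> f t \<ge> 0" "\<And>t. t \<ge> 0 \<Longrightarrow> f t \<le> A + B * t\<^sup>2"
    and "A \<ge> 0" "B \<ge> 0" and W: "W > 0" and x: "x > 0" and a: "a \<ge> 2"
    and int: "integrable M (\<lambda>\<omega>. lb_kernel W a x (Y \<omega>))"
    and nonneg: "AE \<omega> in M. lb_kernel W a x (Y \<omega>) \<ge> 0"
  shows "expectation (\<lambda>\<omega>. lb_kernel W a x (Y \<omega>)) \<le> A + 2 * B * x\<^sup>2"
proof -
  let ?K = "lb_kernel W a x"
  have g0: "lb_density f W y \<ge> 0" for y using f W by (simp add: lb_density_def indicator_def)
  have "ennreal (expectation (\<lambda>\<omega>. ?K (Y \<omega>))) = (\<integral>\<^sup>+\<omega>. ennreal (?K (Y \<omega>)) \<partial>M)"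
    using int nonneg by (rule nn_integral_eq_integral[symmetric])
  also have "\<dots> = (\<integral>\<^sup>+y. ennreal (lb_density f W y) * ennreal (?K y) \<partial>lborel)"
    by (rule distributed_nn_integral[OF Y, symmetric]) measurable
  also have "\<dots> = (\<integral>\<^sup>+y. ennreal (erlang_density (a - 1) (a / x) y * f y) \<partial>lborel)"
    using g0 lb_density_times_kernel[OF a W x]
    by (intro nn_integral_cong) (simp add: ennreal_mult'[symmetric])
  also have "\<dots> \<le> ennreal (A + 2 * B * x\<^sup>2)"
    using erlang_nn_expectation_le[of a x A B f] assms by simp
  finally show ?thesis using assms(4,5) by (subst (asm) ennreal_le_iff) auto
qed

text \<open>Restrict the integral to the window from \<open>lb_kernel_ge\<close>: there \<open>K\<^sup>2\<close> is of order \<open>a\<close> and the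
  length-biased density is at least \<open>x * b / W\<close>, and the window has length \<open>x / sqrt a\<close>.\<close>

lemma (in prob_space) lb_kernel_second_moment_ge:
  assumes Y: "distributed M lborel Y (\<lambda>y. ennreal (lb_density f W y))"
    and f: "\<And>t. t \<ge> 0 \<Longrightarrow> f t \<ge> 0"
    and W: "W > 0" and x: "x > 0" and a: "a \<ge> 1"
    and window: "\<And>y. x \<le> y \<Longrightarrow> y \<le> x + x / sqrt a \<Longrightarrow> f y \<ge> b" and b: "b \<ge> 0"
    and int: "integrable M (\<lambda>\<omega>. (lb_kernel W a x (Y \<omega>))\<^sup>2)"
  shows "b * W / (16 * exp 4 * x\<^sup>2) * sqrt a \<le> expectation (\<lambda>\<omega>. (lb_kernel W a x (Y \<omega>))\<^sup>2)"
proof -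
  let ?K = "lb_kernel W a x" and ?g = "lb_density f W"
  let ?I = "{x..x + x / sqrt a}"
  define c where "c = W / (4 * exp 2 * x\<^sup>2) * sqrt a"
  have c: "c \<ge> 0" using W by (simp add: c_def)
  have g0: "?g y \<ge> 0" for y using f W by (simp add: lb_density_def indicator_def)
  have int': "integrable lborel (\<lambda>y. ?g y * (?K y)\<^sup>2)"
    using int g0 by (subst distributed_integrable[OF Y]) auto
  have sa: "sqrt a > 0" "sqrt a * sqrt a = a" using a by auto
  have "b * W / (16 * exp 4 * x\<^sup>2) * sqrt a = x * b / W * c\<^sup>2 * (x / sqrt a)"
  proof -
    have "c\<^sup>2 = W\<^sup>2 / (16 * exp 4 * x ^ 4) * a"
      by (simp add: c_def power_mult_distrib power_divide exp_double[symmetric])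
    moreover have "x * b / W * (W\<^sup>2 / (16 * E * x ^ 4) * (s * s)) * (x / s) = b * W / (16 * E * x\<^sup>2) * s"
      if "s > 0" "E > 0" for s E :: real
      using that x W by (simp add: field_simps power2_eq_square power4_eq_xxxx)
    from this[of "sqrt a" "exp 4"] have
      "x * b / W * (W\<^sup>2 / (16 * exp 4 * x ^ 4) * a) * (x / sqrt a) = b * W / (16 * exp 4 * x\<^sup>2) * sqrt a"
      using sa by simp
    ultimately show ?thesis by simp
  qed
  also have "\<dots> = (LINT y|lborel. x * b / W * c\<^sup>2 * indicator ?I y)"
    using x sa by simp
  also have "\<dots> \<le> (LINT y|lborel. ?g y * (?K y)\<^sup>2)"
  proof (rule integral_mono)
    show "integrable lborel (\<lambda>y. x * b / W * c\<^sup>2 * indicator ?I y)"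
      by (intro integrable_mult_right integrable_real_indicator) (auto simp: emeasure_lborel_Icc_eq)
    fix y
    show "x * b / W * c\<^sup>2 * indicator ?I y \<le> ?g y * (?K y)\<^sup>2"
    proof (cases "y \<in> ?I")
      case True
      have "x * b / W \<le> ?g y"
        using True window[of y] x W b
        by (simp add: lb_density_def divide_right_mono mult_mono)
      moreover have "c\<^sup>2 \<le> (?K y)\<^sup>2"
        using True lb_kernel_ge[OF a _ x, of W y] W c by (intro power_mono) (auto simp: c_def)
      ultimately have "x * b / W * c\<^sup>2 \<le> ?g y * (?K y)\<^sup>2"
        using g0 by (intro mult_mono) auto
      then show ?thesis using True by simp
    qed (use g0 in auto)
  qed (rule int')
  also have "\<dots> = expectation (\<lambda>\<omega>. (?K (Y \<omega>))\<^sup>2)"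
    using g0 by (intro distributed_integral[OF Y]) auto
  finally show ?thesis .
qed

section \<open>Central limit theorem for rows of small bounded variables\<close>

lemma weak_conv_m_cong_eventually:
  assumes "\<forall>\<^sub>F n in sequentially. \<mu> n = \<nu> n" "weak_conv_m \<nu> N"
  shows "weak_conv_m \<mu> N"
  unfolding weak_conv_m_def weak_conv_def
proof (intro allI impI)
  fix z assume "isCont (cdf N) z"
  then have "(\<lambda>n. cdf (\<nu> n) z) \<longlonglongrightarrow> cdf N z"
    using assms(2) by (simp add: weak_conv_m_def weak_conv_def)
  moreover have "\<forall>\<^sub>F n in sequentially. cdf (\<nu> n) z = cdf (\<mu> n) z"
    using assms(1) by eventually_elim simp
  ultimately show "(\<lambda>n. cdf (\<mu> n) z) \<longlonglongrightarrow> cdf N z"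
    by (rule Lim_transform_eventually)
qed

lemma (in prob_space) expectation_square_sum_indep:
  fixes Z :: "'i \<Rightarrow> 'a \<Rightarrow> real"
  assumes "finite I" "indep_vars (\<lambda>_. borel) Z I"
    and "\<And>i. i \<in> I \<Longrightarrow> integrable M (\<lambda>\<omega>. (Z i \<omega>)\<^sup>2)"
    and "\<And>i. i \<in> I \<Longrightarrow> expectation (Z i) = 0"
  shows "integrable M (\<lambda>\<omega>. (\<Sum>i\<in>I. Z i \<omega>)\<^sup>2) \<and>
    expectation (\<lambda>\<omega>. (\<Sum>i\<in>I. Z i \<omega>)\<^sup>2) = (\<Sum>i\<in>I. expectation (\<lambda>\<omega>. (Z i \<omega>)\<^sup>2))"
  using assms
proof (induction I rule: finite_induct)
  case empty
  then show ?case by simp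
next
  case (insert i I)
  have meas: "random_variable borel (Z j)" if "j \<in> insert i I" for j
    using insert.prems(1) that by (auto simp: indep_vars_def2)
  have int: "integrable M (Z j)" if "j \<in> insert i I" for j
    by (rule square_integrable_imp_integrable) (use meas insert.prems that in auto)
  define S where "S \<omega> = (\<Sum>j\<in>I. Z j \<omega>)" for \<omega>
  have IH: "integrable M (\<lambda>\<omega>. (S \<omega>)\<^sup>2)"
    "expectation (\<lambda>\<omega>. (S \<omega>)\<^sup>2) = (\<Sum>j\<in>I. expectation (\<lambda>\<omega>. (Z j \<omega>)\<^sup>2))"
    using insert indep_vars_subset[OF insert.prems(1), of I] by (auto simp: S_def)
  have iv: "indep_var borel (Z i) borel S"
    unfolding S_def[abs_def] using insert by (intro indep_vars_sum) auto
  have intS: "integrable M S" unfolding S_def[abs_def] using int by auto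
  have prod: "integrable M (\<lambda>\<omega>. Z i \<omega> * S \<omega>)" "expectation (\<lambda>\<omega>. Z i \<omega> * S \<omega>) = 0"
    using indep_var_integrable[OF iv int intS] indep_var_lebesgue_integral[OF iv int intS]
      insert.prems(3)[of i] by auto
  have eq: "(\<Sum>j\<in>insert i I. Z j \<omega>)\<^sup>2 = (Z i \<omega>)\<^sup>2 + 2 * (Z i \<omega> * S \<omega>) + (S \<omega>)\<^sup>2" for \<omega>
    using insert by (simp add: S_def power2_sum algebra_simps)
  show ?case
    unfolding eq using insert prod IH by simp
qed

text \<open>By independence the characteristic function of the row sum is a product, which is compared factor by
  factor with \<open>(1 - t\<^sup>2 / (2 * n)) ^ n\<close>. The second order Taylor error of one factor is at most
  \<open>t\<^sup>2 / 6\<close> times the mean of \<open>\<bar>t\<bar> * \<bar>X\<bar>\<^sup>3\<close>, and \<open>\<bar>X\<bar>\<^sup>3 \<le> \<epsilon> n * X\<^sup>2\<close> makes this a null sequence divided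
  by \<open>n\<close>, so the \<open>n\<close> errors together vanish. The three conditions on the summands are only required
  eventually, since for small \<open>n\<close> normalised summands may fail to exist.\<close>

lemma (in prob_space) clt_bounded_rows:
  fixes X :: "nat \<Rightarrow> nat \<Rightarrow> 'a \<Rightarrow> real" and \<epsilon> :: "nat \<Rightarrow> real"
  assumes indep: "\<And>n. indep_vars (\<lambda>_. borel) (X n) {1..n}"
    and mean: "\<forall>\<^sub>F n in sequentially. \<forall>i\<in>{1..n}. expectation (X n i) = 0"
    and var: "\<forall>\<^sub>F n in sequentially. \<forall>i\<in>{1..n}. expectation (\<lambda>\<omega>. (X n i \<omega>)\<^sup>2) = 1 / n"
    and bdd: "\<forall>\<^sub>F n in sequentially. \<forall>i\<in>{1..n}. AE \<omega> in M. \<bar>X n i \<omega>\<bar> \<le> \<epsilon> n"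
    and small: "\<epsilon> \<longlonglongrightarrow> 0"
  shows "weak_conv_m (\<lambda>n. distr M borel (\<lambda>\<omega>. \<Sum>i=1..n. X n i \<omega>)) std_normal_distribution"
proof (rule levy_continuity)
  have rv: "random_variable borel (X n i)" if "i \<in> {1..n}" for n i
    using indep[of n] that by (simp add: indep_vars_def2)
  show "real_distribution (distr M borel (\<lambda>\<omega>. \<Sum>i=1..n. X n i \<omega>))" for n
    using rv by (intro real_distribution_distr borel_measurable_sum)
  show "real_distribution std_normal_distribution"
    by (rule real_dist_normal_dist)
  fix t :: real
  let ?g = "\<lambda>n. 1 - t\<^sup>2 * (1 / real n) / 2"
  have main: "\<forall>\<^sub>F n in sequentially. cmod (char (distr M borel (\<lambda>\<omega>. \<Sum>i=1..n. X n i \<omega>)) t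
      - of_real ((1 + (- (t\<^sup>2) / 2) / n) ^ n)) \<le> \<bar>t\<bar> ^ 3 / 6 * \<epsilon> n"
    using mean var bdd eventually_ge_at_top[of "nat \<lceil>t\<^sup>2 / 4\<rceil> + 1"]
  proof eventually_elim
    case (elim n)
    \<comment> \<open>this makes the limiting factors lie in \<open>[-1, 1]\<close>, as needed to compare the products\<close>
    have n: "n > 0" "t\<^sup>2 / 4 \<le> n" using elim(4) by linarith+
    have bound: "cmod (char (distr M borel (X n i)) t - of_real (?g n)) \<le> \<bar>t\<bar> ^ 3 / 6 * \<epsilon> n / n"
      if i: "i \<in> {1..n}" for i
    proof -
      note [measurable] = rv[OF i]
      have b: "AE \<omega> in M. \<bar>X n i \<omega>\<bar> \<le> \<epsilon> n" using elim i by auto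
      have b2: "AE \<omega> in M. (X n i \<omega>)\<^sup>2 \<le> (\<epsilon> n)\<^sup>2"
        using b by eventually_elim (metis abs_ge_zero power2_abs power_mono)
      have int: "integrable M (X n i)"
        using b by (intro integrable_const_bound[where B = "\<epsilon> n"]) auto
      have int2: "integrable M (\<lambda>\<omega>. (X n i \<omega>)\<^sup>2)"
        using b2 by (intro integrable_const_bound[where B = "(\<epsilon> n)\<^sup>2"]) auto
      have "variance (X n i) = 1 / n" using elim i by auto
      then have "cmod (char (distr M borel (X n i)) t - of_real (?g n))
          \<le> t\<^sup>2 / 6 * expectation (\<lambda>\<omega>. min (6 * (X n i \<omega>)\<^sup>2) (\<bar>t\<bar> * \<bar>X n i \<omega>\<bar> ^ 3))"
        using char_approx3'[OF rv[OF i] int int2 _ _ refl, of "1 / n" t] elim i by simp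
      also have "\<dots> \<le> t\<^sup>2 / 6 * expectation (\<lambda>\<omega>. \<bar>t\<bar> * \<epsilon> n * (X n i \<omega>)\<^sup>2)"
      proof (intro mult_left_mono integral_mono_AE)
        show "integrable M (\<lambda>\<omega>. min (6 * (X n i \<omega>)\<^sup>2) (\<bar>t\<bar> * \<bar>X n i \<omega>\<bar> ^ 3))"
          by (rule Bochner_Integration.integrable_bound[where f = "\<lambda>\<omega>. 6 * (X n i \<omega>)\<^sup>2"])
             (use int2 in auto)
        show "AE \<omega> in M. min (6 * (X n i \<omega>)\<^sup>2) (\<bar>t\<bar> * \<bar>X n i \<omega>\<bar> ^ 3) \<le> \<bar>t\<bar> * \<epsilon> n * (X n i \<omega>)\<^sup>2"
          using b
        proof eventually_elim
          case (elim \<omega>)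
          have "\<bar>X n i \<omega>\<bar> ^ 3 = \<bar>X n i \<omega>\<bar> * (X n i \<omega>)\<^sup>2"
            by (simp add: power3_eq_cube power2_eq_square mult.assoc)
          also have "\<dots> \<le> \<epsilon> n * (X n i \<omega>)\<^sup>2"
            using elim by (intro mult_right_mono) auto
          finally have "\<bar>t\<bar> * \<bar>X n i \<omega>\<bar> ^ 3 \<le> \<bar>t\<bar> * (\<epsilon> n * (X n i \<omega>)\<^sup>2)"
            by (intro mult_left_mono) auto
          then show ?case by (simp add: mult.assoc)
        qed
      qed (use int2 in auto)
      also have "\<dots> = \<bar>t\<bar> ^ 3 / 6 * \<epsilon> n / n"
        using elim i by (simp add: power3_eq_cube power2_eq_square)
      finally show ?thesis .
    qed
    have g1: "\<bar>?g n\<bar> \<le> 1"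
    proof -
      have "t\<^sup>2 * (1 / real n) / 2 \<le> 2" using n by (simp add: field_simps)
      moreover have "t\<^sup>2 * (1 / real n) / 2 \<ge> 0" by simp
      ultimately show ?thesis by linarith
    qed
    have "char (distr M borel (\<lambda>\<omega>. \<Sum>i=1..n. X n i \<omega>)) t = (\<Prod>i=1..n. char (distr M borel (X n i)) t)"
      by (rule char_distr_sum[OF indep])
    moreover have "of_real ((1 + (- (t\<^sup>2) / 2) / n) ^ n) = (\<Prod>i=1..n. complex_of_real (?g n))"
      by (simp add: prod_constant mult.commute)
    ultimately have "cmod (char (distr M borel (\<lambda>\<omega>. \<Sum>i=1..n. X n i \<omega>)) t
          - of_real ((1 + (- (t\<^sup>2) / 2) / n) ^ n))
        = cmod ((\<Prod>i=1..n. char (distr M borel (X n i)) t) - (\<Prod>i=1..n. complex_of_real (?g n)))"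
      by (simp only:)
    also have "\<dots> \<le> (\<Sum>i=1..n. cmod (char (distr M borel (X n i)) t - of_real (?g n)))"
    proof (rule norm_prod_diff)
      show "cmod (char (distr M borel (X n i)) t) \<le> 1" if "i \<in> {1..n}" for i
        using real_distribution.cmod_char_le_1[OF real_distribution_distr[OF rv[OF that]]] .
      show "cmod (of_real (?g n)) \<le> 1" for i
        using g1 by (simp only: norm_of_real)
    qed
    also have "\<dots> \<le> (\<Sum>i=1..n. \<bar>t\<bar> ^ 3 / 6 * \<epsilon> n / n)"
      by (intro sum_mono bound)
    also have "\<dots> = \<bar>t\<bar> ^ 3 / 6 * \<epsilon> n" using n by simp
    finally show ?case .
  qed
  have "(\<lambda>n. \<bar>t\<bar> ^ 3 / 6 * \<epsilon> n) \<longlonglongrightarrow> 0"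
    using tendsto_mult_right_zero[OF small] .
  from Lim_null_comparison[OF main this]
  have diff: "(\<lambda>n. char (distr M borel (\<lambda>\<omega>. \<Sum>i=1..n. X n i \<omega>)) t
      - of_real ((1 + (- (t\<^sup>2) / 2) / n) ^ n)) \<longlonglongrightarrow> 0" .
  have "(\<lambda>n. complex_of_real ((1 + (- (t\<^sup>2) / 2) / n) ^ n)) \<longlonglongrightarrow> complex_of_real (exp (- (t\<^sup>2) / 2))"
    by (rule isCont_tendsto_compose[OF _ tendsto_exp_limit_sequentially]) auto
  then have "(\<lambda>n. char (distr M borel (\<lambda>\<omega>. \<Sum>i=1..n. X n i \<omega>)) t) \<longlonglongrightarrow> complex_of_real (exp (- (t\<^sup>2) / 2))"
    by (rule Lim_transform) (rule diff)
  then show "(\<lambda>n. char (distr M borel (\<lambda>\<omega>. \<Sum>i=1..n. X n i \<omega>)) t) \<longlonglongrightarrow> char std_normal_distribution t"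
    by (simp add: char_std_normal_distribution)
qed

text \<open>The standardised mean is the row sum of \<open>(h n (Y i) - m n) / sqrt (n * v n)\<close> as soon as \<open>h n (Y i)\<close> is
  bounded and has positive variance. For the finitely many other \<open>n\<close> the two may differ, as
  \<open>expectation\<close> is \<open>0\<close> for variables that are not integrable.\<close>

lemma (in prob_space) clt_bounded_sample_mean:
  fixes Y :: "nat \<Rightarrow> 'a \<Rightarrow> real" and h :: "nat \<Rightarrow> real \<Rightarrow> real" and B m v :: "nat \<Rightarrow> real"
  assumes indep: "indep_vars (\<lambda>_. borel) Y {1..}"
    and h: "\<And>n. h n \<in> borel_measurable borel"
    and mean: "\<And>n i. i \<ge> 1 \<Longrightarrow> expectation (\<lambda>\<omega>. h n (Y i \<omega>)) = m n"
    and var: "\<And>n i. i \<ge> 1 \<Longrightarrow> variance (\<lambda>\<omega>. h n (Y i \<omega>)) = v n"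
    and bdd: "\<forall>\<^sub>F n in sequentially. \<forall>i\<ge>1. AE \<omega> in M. \<bar>h n (Y i \<omega>) - m n\<bar> \<le> B n"
    and pos: "\<forall>\<^sub>F n in sequentially. v n > 0"
    and small: "(\<lambda>n. B n / sqrt (n * v n)) \<longlonglongrightarrow> 0"
  defines "T \<equiv> \<lambda>n \<omega>. (\<Sum>i=1..n. h n (Y i \<omega>)) / n"
  shows "weak_conv_m (\<lambda>n. distr M borel (\<lambda>\<omega>. (T n \<omega> - expectation (T n)) / sqrt (variance (T n))))
    std_normal_distribution"
proof -
  define X where "X n i \<omega> = (h n (Y i \<omega>) - m n) / sqrt (n * v n)" for n i \<omega>
  note [measurable] = h
  have rv [measurable]: "random_variable borel (Y i)" if "i \<ge> 1" for i
    using indep that by (simp add: indep_vars_def2)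
  have indepC: "indep_vars (\<lambda>_. borel) (\<lambda>i \<omega>. h n (Y i \<omega>) - m n) {1..n}" for n
    by (rule indep_vars_compose2[OF indep_vars_subset[OF indep]]) auto
  have indepX: "indep_vars (\<lambda>_. borel) (X n) {1..n}" for n
    unfolding X_def by (rule indep_vars_compose2[OF indep_vars_subset[OF indep]]) auto
  have centred: "\<forall>\<^sub>F n in sequentially. \<forall>i\<ge>1. integrable M (\<lambda>\<omega>. h n (Y i \<omega>))
      \<and> expectation (\<lambda>\<omega>. h n (Y i \<omega>) - m n) = 0
      \<and> integrable M (\<lambda>\<omega>. (h n (Y i \<omega>) - m n)\<^sup>2)
      \<and> expectation (\<lambda>\<omega>. (h n (Y i \<omega>) - m n)\<^sup>2) = v n"
    using bdd
  proof eventually_elim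
    case (elim n)
    show ?case
    proof (intro allI impI)
      fix i :: nat assume i: "i \<ge> 1"
      note [measurable] = rv[OF i]
      have b: "AE \<omega> in M. \<bar>h n (Y i \<omega>) - m n\<bar> \<le> B n" using elim i by auto
      have b2: "AE \<omega> in M. (h n (Y i \<omega>) - m n)\<^sup>2 \<le> (B n)\<^sup>2"
        using b by eventually_elim (metis abs_ge_zero power2_abs power_mono)
      have int: "integrable M (\<lambda>\<omega>. h n (Y i \<omega>) - m n)"
        using b by (intro integrable_const_bound[where B = "B n"]) auto
      then have "integrable M (\<lambda>\<omega>. (h n (Y i \<omega>) - m n) + m n)" by (intro Bochner_Integration.integrable_add) auto
      then have int': "integrable M (\<lambda>\<omega>. h n (Y i \<omega>))" by simp
      moreover have "integrable M (\<lambda>\<omega>. (h n (Y i \<omega>) - m n)\<^sup>2)"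
        using b2 by (intro integrable_const_bound[where B = "(B n)\<^sup>2"]) auto
      moreover have "expectation (\<lambda>\<omega>. h n (Y i \<omega>) - m n) = 0"
        using int' mean[OF i, of n] by (subst Bochner_Integration.integral_diff) (auto simp: prob_space)
      moreover have "expectation (\<lambda>\<omega>. (h n (Y i \<omega>) - m n)\<^sup>2) = v n"
        using var[OF i, of n] unfolding mean[OF i] .
      ultimately show "integrable M (\<lambda>\<omega>. h n (Y i \<omega>))
        \<and> expectation (\<lambda>\<omega>. h n (Y i \<omega>) - m n) = 0
        \<and> integrable M (\<lambda>\<omega>. (h n (Y i \<omega>) - m n)\<^sup>2)
        \<and> expectation (\<lambda>\<omega>. (h n (Y i \<omega>) - m n)\<^sup>2) = v n"
        by blast
    qed
  qed
  have clt: "weak_conv_m (\<lambda>n. distr M borel (\<lambda>\<omega>. \<Sum>i=1..n. X n i \<omega>)) std_normal_distribution"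
  proof (rule clt_bounded_rows[OF indepX _ _ _ small])
    show "\<forall>\<^sub>F n in sequentially. \<forall>i\<in>{1..n}. expectation (X n i) = 0"
      using centred
    proof eventually_elim
      case (elim n)
      have "expectation (X n i) = expectation (\<lambda>\<omega>. h n (Y i \<omega>) - m n) / sqrt (n * v n)" for i
        unfolding X_def by (rule integral_divide_zero)
      then show ?case using elim by (metis atLeastAtMost_iff div_0)
    qed
    show "\<forall>\<^sub>F n in sequentially. \<forall>i\<in>{1..n}. expectation (\<lambda>\<omega>. (X n i \<omega>)\<^sup>2) = 1 / n"
      using centred pos
    proof eventually_elim
      case (elim n)
      have "(X n i \<omega>)\<^sup>2 = (h n (Y i \<omega>) - m n)\<^sup>2 / (n * v n)" for i \<omega>
        using elim(2) by (simp add: X_def power_divide)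
      then have "expectation (\<lambda>\<omega>. (X n i \<omega>)\<^sup>2) = expectation (\<lambda>\<omega>. (h n (Y i \<omega>) - m n)\<^sup>2) / (n * v n)" for i
        by (simp only: integral_divide_zero)
      moreover have "v n / (n * v n) = 1 / n" using elim(2) by simp
      ultimately show ?case using elim(1) by (metis atLeastAtMost_iff)
    qed
    show "\<forall>\<^sub>F n in sequentially. \<forall>i\<in>{1..n}. AE \<omega> in M. \<bar>X n i \<omega>\<bar> \<le> B n / sqrt (n * v n)"
      using bdd pos
    proof eventually_elim
      case (elim n)
      show ?case
      proof
        fix i assume "i \<in> {1..n}"
        then have "AE \<omega> in M. \<bar>h n (Y i \<omega>) - m n\<bar> \<le> B n" using elim(1) by simp
        then show "AE \<omega> in M. \<bar>X n i \<omega>\<bar> \<le> B n / sqrt (n * v n)"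
          by eventually_elim (use elim(2) in \<open>auto simp: X_def intro!: divide_right_mono\<close>)
      qed
    qed
  qed
  have "\<forall>\<^sub>F n in sequentially.
      (\<lambda>\<omega>. (T n \<omega> - expectation (T n)) / sqrt (variance (T n))) = (\<lambda>\<omega>. \<Sum>i=1..n. X n i \<omega>)"
    using centred pos eventually_gt_at_top[of 0]
  proof eventually_elim
    case (elim n)
    have ET: "expectation (T n) = m n"
    proof -
      have "expectation (T n) = (\<Sum>i=1..n. expectation (\<lambda>\<omega>. h n (Y i \<omega>))) / n"
        unfolding T_def integral_divide_zero
        using elim(1) by (subst Bochner_Integration.integral_sum) auto
      also have "\<dots> = (\<Sum>i=1..n. m n) / n"
        using mean by (intro arg_cong2[where f = "(/)"] sum.cong) auto
      finally show ?thesis using elim(3) by simp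
    qed
    have TX: "T n \<omega> - m n = (\<Sum>i=1..n. h n (Y i \<omega>) - m n) / n" for \<omega>
      using elim(3) by (simp add: T_def sum_subtractf diff_divide_distrib)
    have "expectation (\<lambda>\<omega>. (\<Sum>i=1..n. h n (Y i \<omega>) - m n)\<^sup>2)
        = (\<Sum>i=1..n. expectation (\<lambda>\<omega>. (h n (Y i \<omega>) - m n)\<^sup>2))"
      using elim(1) by (intro expectation_square_sum_indep[OF _ indepC, THEN conjunct2]) auto
    also have "\<dots> = (\<Sum>i=1..n. v n)"
      using elim(1) by (intro sum.cong) auto
    also have "\<dots> = n * v n" by simp
    finally have V: "expectation (\<lambda>\<omega>. (\<Sum>i=1..n. h n (Y i \<omega>) - m n)\<^sup>2) = n * v n" .
    have VT: "variance (T n) = v n / n"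
      unfolding ET TX power_divide integral_divide_zero V using elim(3) by (simp add: power2_eq_square)
    have "real n * sqrt (v n / n) = sqrt ((real n)\<^sup>2 * (v n / n))"
      by (simp only: real_sqrt_mult real_sqrt_abs abs_of_nat)
    also have "(real n)\<^sup>2 * (v n / n) = n * v n" using elim(3) by (simp add: power2_eq_square)
    finally have scale: "real n * sqrt (v n / n) = sqrt (n * v n)" .
    have "(T n \<omega> - m n) / sqrt (v n / n) = (\<Sum>i=1..n. X n i \<omega>)" for \<omega>
      by (simp only: TX X_def divide_divide_eq_left scale sum_divide_distrib)
    then show ?case unfolding VT unfolding ET by (rule ext)
  qed
  then have "\<forall>\<^sub>F n in sequentially. distr M borel (\<lambda>\<omega>. (T n \<omega> - expectation (T n)) / sqrt (variance (T n)))
      = distr M borel (\<lambda>\<omega>. \<Sum>i=1..n. X n i \<omega>)"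
    by eventually_elim (rule arg_cong[where f = "distr M borel"])
  then show ?thesis using clt by (rule weak_conv_m_cong_eventually)
qed

section \<open>Asymptotic normality of the length-biased gamma kernel estimator\<close>

theorem theorem4p1:
  fixes M :: "'a measure" and Y :: "nat \<Rightarrow> 'a \<Rightarrow> real"
    and f f' f'' :: "real \<Rightarrow> real" and W x \<delta> :: real and \<alpha> :: "nat \<Rightarrow> nat"
  assumes "prob_space M"
    and f_nonneg: "\<And>t. t \<ge> 0 \<Longrightarrow> f t \<ge> 0"
    and f_density: "(\<integral>\<^sup>+ t\<in>{0..}. ennreal (f t) \<partial>lborel) = 1"
    and mean_finite: "set_integrable lborel {0..} (\<lambda>t. t * f t)"
    and W: "W = (LINT t:{0..}|lborel. t * f t)" "0 < W"
    and f': "\<And>t. t \<ge> 0 \<Longrightarrow> (f has_real_derivative f' t) (at t within {0..})"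
    and f'': "\<And>t. t \<ge> 0 \<Longrightarrow> (f' has_real_derivative f'' t) (at t within {0..})"
    and f''_cont: "continuous_on {0..} f''"
    and f''_bounded: "bounded (f'' ` {0..})"
    and indep: "prob_space.indep_vars M (\<lambda>_. borel) Y {1..}"
    and distr: "\<And>i. i \<ge> 1 \<Longrightarrow> distributed M lborel (Y i) (\<lambda>y. ennreal (lb_density f W y))"
    and x: "0 < x" "0 < f x"
    and \<alpha>_pos: "\<And>n. n \<ge> 1 \<Longrightarrow> \<alpha> n \<ge> 1"
    and \<delta>: "0 < \<delta>" "\<delta> < 2"
    and \<alpha>_asymp: "(\<lambda>n. real (\<alpha> n) / real n powr \<delta>) \<longlonglongrightarrow> 1"
  shows "weak_conv_m
    (\<lambda>n. distr M borel (\<lambda>\<omega>.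
       (lb_estimator W Y n (\<alpha> n) x \<omega> - prob_space.expectation M (lb_estimator W Y n (\<alpha> n) x))
         / sqrt (prob_space.variance M (lb_estimator W Y n (\<alpha> n) x))))
    std_normal_distribution"
proof -
  interpret prob_space M by fact
  define K where "K n = lb_kernel W (\<alpha> n) x" for n
  have K_meas [measurable]: "K n \<in> borel_measurable borel" for n by (simp add: K_def)
  define m where "m n = expectation (\<lambda>\<omega>. K n (Y 1 \<omega>))" for n
  define v where "v n = variance (\<lambda>\<omega>. K n (Y 1 \<omega>))" for n
  have g0: "lb_density f W y \<ge> 0" for y using f_nonneg W by (simp add: lb_density_def indicator_def)
  have transfer: "expectation (\<lambda>\<omega>. h (Y i \<omega>)) = expectation (\<lambda>\<omega>. h (Y 1 \<omega>))"
    if "i \<ge> 1" and [measurable]: "h \<in> borel_measurable borel" for i and h :: "real \<Rightarrow> real"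
    using distributed_integral[OF distr[OF that(1)], of h] distributed_integral[OF distr[of 1], of h] g0
    by simp
  have rv [measurable]: "random_variable borel (Y i)" if "i \<ge> 1" for i
    using indep that by (simp add: indep_vars_def2)
  have Y_nonneg: "AE \<omega> in M. Y i \<omega> \<ge> 0" if "i \<ge> 1" for i
    by (subst distributed_AE2[OF distr[OF that]]) (auto simp: lb_density_def indicator_def)
  define C where "C = 4 * W / x\<^sup>2"

  \<comment> \<open>\<open>\<delta> > 0\<close> enters here: the kernel becomes arbitrarily narrow\<close>
  have \<alpha>_top: "filterlim (\<lambda>n. real (\<alpha> n)) at_top sequentially"
  proof -
    have "filterlim (\<lambda>n. real (\<alpha> n) / real n powr \<delta> * real n powr \<delta>) at_top sequentially"
      by (rule filterlim_tendsto_pos_mult_at_top[OF \<alpha>_asymp])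
         (use \<delta> in \<open>auto intro!: real_powr_at_top[THEN filterlim_compose] filterlim_real_sequentially\<close>)
    then show ?thesis
      by (rule filterlim_mono_eventually[OF _ order_refl order_refl])
         (use eventually_gt_at_top[of 0] in \<open>eventually_elim, auto\<close>)
  qed
  have sqrt_top: "filterlim (\<lambda>n. sqrt (\<alpha> n)) at_top sequentially"
    by (rule filterlim_compose[OF sqrt_at_top \<alpha>_top])
  have \<alpha>3: "\<forall>\<^sub>F n in sequentially. \<alpha> n \<ge> 3"
    using filterlim_at_top[THEN iffD1, OF \<alpha>_top, rule_format, of 3] by eventually_elim simp

  have K_range: "\<forall>\<^sub>F n in sequentially. \<forall>i\<ge>1. AE \<omega> in M. 0 \<le> K n (Y i \<omega>) \<and> K n (Y i \<omega>) \<le> C * sqrt (\<alpha> n)"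
    using \<alpha>3
  proof eventually_elim
    case (elim n)
    show ?case
    proof (intro allI impI)
      fix i :: nat assume "i \<ge> 1"
      from Y_nonneg[OF this] show "AE \<omega> in M. 0 \<le> K n (Y i \<omega>) \<and> K n (Y i \<omega>) \<le> C * sqrt (\<alpha> n)"
        by eventually_elim
           (use elim W x lb_kernel_nonneg lb_kernel_le in \<open>simp add: K_def C_def\<close>)
    qed
  qed
  have K_int: "\<forall>\<^sub>F n in sequentially. integrable M (\<lambda>\<omega>. K n (Y 1 \<omega>)) \<and> integrable M (\<lambda>\<omega>. (K n (Y 1 \<omega>))\<^sup>2)"
    using K_range
  proof eventually_elim
    case (elim n)
    then have b: "AE \<omega> in M. 0 \<le> K n (Y 1 \<omega>) \<and> K n (Y 1 \<omega>) \<le> C * sqrt (\<alpha> n)" by simp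
    have b2: "AE \<omega> in M. (K n (Y 1 \<omega>))\<^sup>2 \<le> (C * sqrt (\<alpha> n))\<^sup>2"
      using b by eventually_elim (auto intro: power_mono)
    show ?case
      using b b2 by (intro conjI integrable_const_bound[where B = "C * sqrt (\<alpha> n)"]
          integrable_const_bound[where B = "(C * sqrt (\<alpha> n))\<^sup>2"]) auto
  qed
  have m_nonneg: "\<forall>\<^sub>F n in sequentially. 0 \<le> m n \<and> m n \<le> C * sqrt (\<alpha> n)"
    using K_range K_int
  proof eventually_elim
    case (elim n)
    then have b: "AE \<omega> in M. 0 \<le> K n (Y 1 \<omega>)" "AE \<omega> in M. K n (Y 1 \<omega>) \<le> C * sqrt (\<alpha> n)" by auto
    have "m n \<le> expectation (\<lambda>\<omega>. C * sqrt (\<alpha> n))"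
      unfolding m_def by (rule integral_mono_AE) (use b elim in auto)
    then show ?case
      using b by (auto simp: m_def prob_space intro: integral_nonneg_AE)
  qed
  \<comment> \<open>kernel value and mean lie in the same interval, so centring does not enlarge the bound\<close>
  have bdd: "\<forall>\<^sub>F n in sequentially. \<forall>i\<ge>1. AE \<omega> in M. \<bar>K n (Y i \<omega>) - m n\<bar> \<le> C * sqrt (\<alpha> n)"
    using K_range m_nonneg
  proof eventually_elim
    case (elim n)
    show ?case
    proof (intro allI impI)
      fix i :: nat assume "i \<ge> 1"
      then have "AE \<omega> in M. 0 \<le> K n (Y i \<omega>) \<and> K n (Y i \<omega>) \<le> C * sqrt (\<alpha> n)" using elim by simp
      then show "AE \<omega> in M. \<bar>K n (Y i \<omega>) - m n\<bar> \<le> C * sqrt (\<alpha> n)"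
        by eventually_elim (use elim(2) in linarith)
    qed
  qed

  obtain A B where AB: "A \<ge> 0" "B \<ge> 0" "\<And>t. t \<ge> 0 \<Longrightarrow> f t \<le> A + B * t\<^sup>2"
    using quadratic_growth_of_bounded_second_deriv[OF f' f'' f''_bounded] by blast
  define m0 where "m0 = A + 2 * B * x\<^sup>2"
  have m_le: "\<forall>\<^sub>F n in sequentially. m n \<le> m0"
    using \<alpha>3 K_range K_int
  proof eventually_elim
    case (elim n)
    then show ?case
      unfolding m_def m0_def K_def
      by (intro lb_kernel_expectation_le[OF distr[of 1] f_nonneg AB(3,1,2) W(2) x(1)])
         (auto simp: K_def)
  qed

  obtain d where d: "d > 0" "\<And>y. x \<le> y \<Longrightarrow> y \<le> x + d \<Longrightarrow> f y \<ge> f x / 2"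
  proof -
    have "(f \<longlongrightarrow> f x) (at x within {0..})"
      using f'[of x] x DERIV_continuous continuous_within by fastforce
    then have "\<forall>\<^sub>F y in at x within {0..}. f y > f x / 2"
      by (rule order_tendstoD) (use x in simp)
    then obtain e where e: "e > 0" "\<And>y. y \<ge> 0 \<Longrightarrow> y \<noteq> x \<Longrightarrow> dist y x < e \<Longrightarrow> f y > f x / 2"
      unfolding eventually_at by auto
    show thesis
    proof (rule that[of "e / 2"])
      show "f y \<ge> f x / 2" if "x \<le> y" "y \<le> x + e / 2" for y
        using e(2)[of y] e(1) that x by (cases "y = x") (auto simp: dist_real_def)
    qed (use e in simp)
  qed
  \<comment> \<open>the constant of \<open>lb_kernel_second_moment_ge\<close> with \<open>f x / 2\<close> as lower bound of \<open>f\<close>\<close>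
  define c where "c = f x / 2 * W / (16 * exp 4 * x\<^sup>2)"
  have c: "c > 0" using x W by (simp add: c_def)
  have v_ge: "\<forall>\<^sub>F n in sequentially. c / 2 * sqrt (\<alpha> n) \<le> v n"
    using \<alpha>3 K_int m_nonneg m_le
      filterlim_at_top[THEN iffD1, OF sqrt_top, rule_format, of "x / d"]
      filterlim_at_top[THEN iffD1, OF sqrt_top, rule_format, of "2 * m0\<^sup>2 / c"]
  proof eventually_elim
    case (elim n)
    have s: "sqrt (\<alpha> n) > 0" using elim(1) by simp
    have w: "x / sqrt (\<alpha> n) \<le> d" using elim(5) s d(1) by (simp add: field_simps)
    have "c * sqrt (\<alpha> n) \<le> expectation (\<lambda>\<omega>. (K n (Y 1 \<omega>))\<^sup>2)"
      unfolding c_def K_def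
      by (rule lb_kernel_second_moment_ge[OF distr[of 1] f_nonneg W(2) x(1)])
         (use elim w d x in \<open>auto simp: K_def\<close>)
    moreover have "v n = expectation (\<lambda>\<omega>. (K n (Y 1 \<omega>))\<^sup>2) - (m n)\<^sup>2"
      unfolding v_def m_def using elim by (intro variance_eq) auto
    moreover have "(m n)\<^sup>2 \<le> m0\<^sup>2" using elim by (intro power_mono) auto
    \<comment> \<open>the squared mean uses up at most half of the second moment\<close>
    moreover have "m0\<^sup>2 \<le> c / 2 * sqrt (\<alpha> n)" using elim(6) c by (simp add: field_simps)
    ultimately show ?case by linarith
  qed
  have v_pos: "\<forall>\<^sub>F n in sequentially. v n > 0"
    using v_ge \<alpha>3
  proof eventually_elim
    case (elim n)
    have "0 < c / 2 * sqrt (\<alpha> n)" using elim(2) c by simp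
    then show ?case using elim(1) by linarith
  qed

  \<comment> \<open>the only place where \<open>\<delta> < 2\<close> matters\<close>
  have ratio: "(\<lambda>n. sqrt (\<alpha> n) / n) \<longlonglongrightarrow> 0"
  proof -
    have "(\<lambda>n. sqrt (real (\<alpha> n) / real n powr \<delta>) * real n powr (\<delta> / 2 - 1)) \<longlonglongrightarrow> sqrt 1 * 0"
      using \<delta> by (intro tendsto_mult tendsto_real_sqrt \<alpha>_asymp tendsto_neg_powr filterlim_real_sequentially) auto
    then have "(\<lambda>n. sqrt (real (\<alpha> n) / real n powr \<delta>) * real n powr (\<delta> / 2 - 1)) \<longlonglongrightarrow> 0" by simp
    moreover have "\<forall>\<^sub>F n in sequentially.
        sqrt (real (\<alpha> n) / real n powr \<delta>) * real n powr (\<delta> / 2 - 1) = sqrt (\<alpha> n) / n"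
      using eventually_gt_at_top[of 0]
    proof eventually_elim
      case (elim n)
      have "sqrt (real n powr \<delta>) = real n powr (\<delta> / 2)"
        by (simp add: powr_half_sqrt[symmetric] powr_powr)
      moreover have "real n powr (\<delta> / 2 - 1) = real n powr (\<delta> / 2) / n"
        using elim by (simp add: powr_diff)
      ultimately show ?case using elim by (simp add: real_sqrt_divide)
    qed
    ultimately show ?thesis by (rule Lim_transform_eventually)
  qed
  have small: "(\<lambda>n. C * sqrt (\<alpha> n) / sqrt (n * v n)) \<longlonglongrightarrow> 0"
  proof (rule Lim_null_comparison)
    show "\<forall>\<^sub>F n in sequentially. norm (C * sqrt (\<alpha> n) / sqrt (n * v n))
        \<le> sqrt (2 * C\<^sup>2 / c * (sqrt (\<alpha> n) / n))"
      using v_ge v_pos \<alpha>3 eventually_gt_at_top[of 0]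
    proof eventually_elim
      case (elim n)
      have s: "sqrt (\<alpha> n) > 0" using elim(3) by simp
      have "(C * sqrt (\<alpha> n))\<^sup>2 / (n * v n) \<le> (C * sqrt (\<alpha> n))\<^sup>2 / (n * (c / 2 * sqrt (\<alpha> n)))"
        using elim s c by (intro divide_left_mono mult_left_mono mult_pos_pos) auto
      also have "\<dots> = 2 * C\<^sup>2 / c * (sqrt (\<alpha> n) / n)"
        using s c by (simp add: power2_eq_square divide_simps)
      finally have "sqrt ((C * sqrt (\<alpha> n))\<^sup>2 / (n * v n)) \<le> sqrt (2 * C\<^sup>2 / c * (sqrt (\<alpha> n) / n))"
        by simp
      then show ?case
        using elim by (simp add: real_sqrt_divide abs_mult real_sqrt_mult)
    qed
    have "(\<lambda>n. sqrt (2 * C\<^sup>2 / c * (sqrt (\<alpha> n) / n))) \<longlonglongrightarrow> sqrt (2 * C\<^sup>2 / c * 0)"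
      by (intro tendsto_real_sqrt tendsto_mult_left ratio)
    then show "(\<lambda>n. sqrt (2 * C\<^sup>2 / c * (sqrt (\<alpha> n) / n))) \<longlonglongrightarrow> 0" by simp
  qed

  have est: "lb_estimator W Y n (\<alpha> n) x = (\<lambda>\<omega>. (\<Sum>i=1..n. K n (Y i \<omega>)) / n)" for n
    by (simp add: fun_eq_iff lb_estimator_eq_kernel_mean K_def)
  show ?thesis
    unfolding est
  proof (rule clt_bounded_sample_mean[OF indep K_meas _ _ bdd v_pos small])
    show mean: "expectation (\<lambda>\<omega>. K n (Y i \<omega>)) = m n" if "i \<ge> 1" for n i
      unfolding m_def by (rule transfer[OF that]) measurable
    show "variance (\<lambda>\<omega>. K n (Y i \<omega>)) = v n" if "i \<ge> 1" for n i
      unfolding v_def mean[OF that] mean[OF order_refl] by (rule transfer[OF that]) measurable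
  qed
qed

end
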